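(* Let $(X,\|\cdot\|)$ be a real Banach space, let $|||\cdot|||$ be another norm on $X$ that is strictly weaker than $\|\cdot\|$, and let $s>0$ be a real number. Then the map $$F: X\to X,\qquad F(x)=\exp\Big(-\frac{1}{|||x|||^{s}}\Big)\cdot x,$$ is not open, where $X$ carries the topology of $\|\cdot\|$ both as domain and as codomain.
   Context: A norm $|||\cdot|||$ on $X$ is strictly weaker than $\|\cdot\|$ if there is a constant $C>0$ with $|||x|||\le C\|x\|$ for all $x\in X$, but the two norms are not equivalent. Convention: $\frac{1}{0}=\infty$ and $\exp(-\infty)=0$, so $F(0)=0$. A map between topological spaces is open if it maps open sets to open sets. *)

theory Defs
  imports "HOL-Analysis.Analysis"
begin

definition is_norm :: "('a::real_vector \<Rightarrow> real) \<Rightarrow> bool" where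
  "is_norm N \<longleftrightarrow>
     (\<forall>x. 0 \<le> N x) \<and>
     (\<forall>x. N x = 0 \<longleftrightarrow> x = 0) \<and>
     (\<forall>a x. N (a *\<^sub>R x) = \<bar>a\<bar> * N x) \<and>
     (\<forall>x y. N (x + y) \<le> N x + N y)"

definition equivalent_norms :: "('a::real_vector \<Rightarrow> real) \<Rightarrow> ('a \<Rightarrow> real) \<Rightarrow> bool" where
  "equivalent_norms N M \<longleftrightarrow> (\<exists>c>0. \<exists>C>0. \<forall>x. c * M x \<le> N x \<and> N x \<le> C * M x)"

definition strictly_weaker_norm :: "('a::real_vector \<Rightarrow> real) \<Rightarrow> ('a \<Rightarrow> real) \<Rightarrow> bool" where
  "strictly_weaker_norm N M \<longleftrightarrow>
     (\<exists>C>0. \<forall>x. N x \<le> C * M x) \<and> \<not> equivalent_norms N M"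

text \<open>The factor \<open>exp (- 1 / t\<^sup>s)\<close> for \<open>t \<ge> 0\<close>. The case \<open>t = 0\<close> encodes the convention
  \<open>1 / 0 = \<infinity>\<close>, \<open>exp (- \<infinity>) = 0\<close>, which differs from HOL's \<open>1 / 0 = 0\<close>.\<close>

definition exp_factor :: "real \<Rightarrow> real \<Rightarrow> real" where
  "exp_factor s t = (if t = 0 then 0 else exp (- (1 / t powr s)))"

definition F_map :: "('a::real_vector \<Rightarrow> real) \<Rightarrow> real \<Rightarrow> 'a \<Rightarrow> 'a" where
  "F_map N s x = exp_factor s (N x) *\<^sub>R x"

end

theory Submission
  imports Defs
begin

text \<open>A strictly weaker norm takes arbitrarily small values on the unit sphere, so \<open>F\<close> maps points
  of that sphere arbitrarily close to \<open>F 0 = 0\<close>. Along each ray the factor increases with the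
  distance from the origin, so these image points are not attained in the open unit ball, whose
  image is therefore not a neighbourhood of \<open>0\<close>.\<close>

text \<open>Take reciprocals in \<open>u < exp u\<close> at \<open>u = 1 / t powr s\<close>. The
  bound is free of exponentials, so the smallness needed of \<open>N x\<close> can be written in
  closed form.\<close>

lemma exp_factor_less_powr:
  assumes "t > 0"
  shows "exp_factor s t < t powr s"
proof -
  have "t powr s > 0" using assms by simp
  then have "1 / t powr s < exp (1 / t powr s)"
    using exp_ge_add_one_self[of "1 / t powr s"] by linarith
  with \<open>t powr s > 0\<close> show ?thesis
    using assms by (simp add: exp_factor_def exp_minus field_simps)
qed

lemma exp_factor_mono:
  assumes "0 < t" "t \<le> u" "0 < s"
  shows "exp_factor s t \<le> exp_factor s u"
proof -
  have "t powr s \<le> u powr s" using assms by (intro powr_mono2) auto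
  then show ?thesis using assms by (simp add: exp_factor_def frac_le)
qed

text \<open>The upper bound of \<open>N\<close> holds, so non-equivalence means that every lower
  bound \<open>c * norm x \<le> N x\<close> with \<open>c > 0\<close> fails. A vector violating it
  for \<open>c = e\<close> is rescaled to the sphere.\<close>

lemma strictly_weaker_norm_small_on_sphere:
  fixes N :: "'a::real_normed_vector \<Rightarrow> real"
  assumes N: "is_norm N" and weaker: "strictly_weaker_norm N norm" and "e > 0"
  obtains x where "norm x = 1" "N x < e"
proof -
  obtain C where "C > 0" "\<And>x. N x \<le> C * norm x" and "\<not> equivalent_norms N norm"
    using weaker unfolding strictly_weaker_norm_def by blast
  then obtain x where x: "N x < e * norm x"
    using \<open>e > 0\<close> unfolding equivalent_norms_def by (meson not_le)
  moreover have "N x \<ge> 0" using N by (simp add: is_norm_def)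
  ultimately have "x \<noteq> 0" by auto
  moreover from this have "N (x /\<^sub>R norm x) < e"
    using N x by (simp add: is_norm_def field_simps)
  ultimately show ?thesis using that[of "x /\<^sub>R norm x"] by simp
qed

text \<open>Equal nonzero images force \<open>y = c *\<^sub>R x\<close> with \<open>c > 0\<close>.
  If \<open>y\<close> were nearer to the origin, then \<open>c < 1\<close>, yet monotonicity of the
  factor along the ray gives \<open>c \<ge> 1\<close>.\<close>

lemma F_map_eq_norm_le:
  fixes N :: "'a::real_normed_vector \<Rightarrow> real"
  assumes N: "is_norm N" and "s > 0" and "x \<noteq> 0" and eq: "F_map N s x = F_map N s y"
  shows "norm x \<le> norm y"
proof (rule ccontr)
  assume less: "\<not> norm x \<le> norm y"
  have pos: "N z > 0" if "z \<noteq> 0" for z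
    using N that unfolding is_norm_def by (metis less_le)
  have fac: "exp_factor s (N z) > 0" if "z \<noteq> 0" for z
    using pos[OF that] by (simp add: exp_factor_def)
  \<comment> \<open>This excludes \<open>y = 0\<close>, where the factor vanishes and the quotient
    \<open>c\<close> would divide by zero.\<close>
  have "F_map N s x \<noteq> 0" using fac[OF \<open>x \<noteq> 0\<close>] \<open>x \<noteq> 0\<close> by (simp add: F_map_def)
  then have "y \<noteq> 0" using eq by (auto simp: F_map_def)
  define c where "c = exp_factor s (N x) / exp_factor s (N y)"
  have "c > 0" using fac \<open>x \<noteq> 0\<close> \<open>y \<noteq> 0\<close> by (simp add: c_def)
  have "y = (1 / exp_factor s (N y)) *\<^sub>R F_map N s y"
    using fac[OF \<open>y \<noteq> 0\<close>] by (simp add: F_map_def)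
  then have y: "y = c *\<^sub>R x"
    unfolding eq[symmetric] by (simp add: F_map_def c_def)
  have "c < 1" using less \<open>c > 0\<close> \<open>x \<noteq> 0\<close> by (simp add: y)
  moreover have "N y = c * N x" using N \<open>c > 0\<close> by (simp add: y is_norm_def)
  ultimately have "N y \<le> N x" using pos[OF \<open>x \<noteq> 0\<close>] by simp
  then have "exp_factor s (N y) \<le> exp_factor s (N x)"
    using exp_factor_mono pos \<open>y \<noteq> 0\<close> \<open>s > 0\<close> by blast
  then have "c \<ge> 1" using fac[OF \<open>y \<noteq> 0\<close>] by (simp add: c_def)
  with \<open>c < 1\<close> show False by simp
qed

theorem theorem2p2:
  fixes N :: "'a::banach \<Rightarrow> real" and s :: real
  assumes "is_norm N"
    and "strictly_weaker_norm N norm"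
    and "s > 0"
  shows "\<not> open_map euclidean euclidean (F_map N s)"
proof
  assume "open_map euclidean euclidean (F_map N s)"
  then have "open (F_map N s ` ball 0 1)" by (simp add: open_map_def)
  moreover have "0 \<in> F_map N s ` ball 0 1"
    by (rule image_eqI[of _ _ 0]) (simp_all add: F_map_def)
  ultimately obtain e where "e > 0" and e: "ball 0 e \<subseteq> F_map N s ` ball 0 1"
    using open_contains_ball by blast
  \<comment> \<open>The threshold is the number whose power \<open>s\<close> is
    \<open>e\<close>.\<close>
  then obtain x where x: "norm x = 1" "N x < e powr (1 / s)"
    using strictly_weaker_norm_small_on_sphere[OF assms(1,2), of "e powr (1 / s)"] by auto
  then have "x \<noteq> 0" by auto
  then have "N x > 0" using assms(1) unfolding is_norm_def by (metis less_le)
  then have "exp_factor s (N x) < N x powr s" by (rule exp_factor_less_powr)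
  also have "\<dots> < (e powr (1 / s)) powr s"
    using x \<open>N x > 0\<close> \<open>s > 0\<close> by (intro powr_less_mono2) auto
  also have "\<dots> = e" using \<open>s > 0\<close> \<open>e > 0\<close> by (simp add: powr_powr)
  \<comment> \<open>On the unit sphere the norm of the image is the factor itself.\<close>
  finally have "norm (F_map N s x) < e"
    using x \<open>N x > 0\<close> by (simp add: F_map_def exp_factor_def)
  then have "F_map N s x \<in> ball 0 e" by simp
  with e obtain y where "norm y < 1" "F_map N s x = F_map N s y" by auto
  then show False
    using F_map_eq_norm_le[OF assms(1,3) \<open>x \<noteq> 0\<close>] x by force
qed

end
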